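(* Let $b_n$, $n\ge0$, be the Bernoulli numbers of the second kind, defined by $\frac{x}{\ln(1+x)}=\sum_{n=0}^\infty b_n x^n$ near $x=0$. Let $m$ be a positive integer and let $\lambda=(\lambda_1,\dots,\lambda_m)$ and $\mu=(\mu_1,\dots,\mu_m)$ be two $m$-tuples of nonnegative integers such that $\lambda\preceq\mu$ (that is, $\lambda$ is majorized by $\mu$). Then $$\Biggl|\prod_{i=1}^m \lambda_i!\,b_{\lambda_i+1}\Biggr|\le \Biggl|\prod_{i=1}^m \mu_i!\,b_{\mu_i+1}\Biggr|.$$
   Context: The function $x/\ln(1+x)$ is extended to $x=0$ by the value $1$; the $b_n$ are its Taylor coefficients at $0$. For $\lambda,\mu\in\mathbb{R}^m$, $\lambda$ is majorized by $\mu$, written $\lambda\preceq\mu$, if $\sum_{i=1}^k \lambda_{[i]}\le\sum_{i=1}^k \mu_{[i]}$ for $k=1,\dots,m-1$ and $\sum_{i=1}^m \lambda_i=\sum_{i=1}^m\mu_i$, where $\lambda_{[1]}\ge\dots\ge\lambda_{[m]}$ and $\mu_{[1]}\ge\dots\ge\mu_{[m]}$ are the rearrangements of $\lambda$ and $\mu$ in descending order. Outer bars denote absolute value. *)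

theory Defs
  imports "HOL-Analysis.Analysis"
begin

definition x_over_ln :: "real \<Rightarrow> real" where
  "x_over_ln x = (if x = 0 then 1 else x / ln (1 + x))"

text \<open>Bernoulli numbers of the second kind, as Taylor coefficients at 0; that the Taylor series
  actually converges to the function near 0 is \<open>bernoulli2_sums\<close> below.\<close>

definition bernoulli2 :: "nat \<Rightarrow> real" where
  "bernoulli2 n = (deriv ^^ n) x_over_ln 0 / fact n"

lemma higher_deriv_at_0_has_fps_expansion:
  fixes f :: "real \<Rightarrow> real"
  assumes "f has_fps_expansion F"
  shows "(deriv ^^ n) f 0 = fact n * fps_nth F n"
proof -
  have "(deriv ^^ n) f has_fps_expansion (fps_deriv ^^ n) F"
    by (induction n) (auto intro: assms has_fps_expansion_deriv)
  hence "(deriv ^^ n) f 0 = fps_nth ((fps_deriv ^^ n) F) 0"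
    by (auto simp: has_fps_expansion_def eval_fps_at_0 dest: eventually_nhds_x_imp_x)
  also have "\<dots> = fact n * fps_nth F n"
    by (simp add: fps_0th_higher_deriv)
  finally show ?thesis .
qed

lemma ln_one_plus_has_fps_expansion:
  "(\<lambda>x::real. ln (1 + x)) has_fps_expansion Abs_fps (\<lambda>n. (-1) ^ Suc n / of_nat n)"
proof (rule has_fps_expansionI)
  have "eventually (\<lambda>x::real. x \<in> {-1<..<1}) (nhds 0)"
    by (intro eventually_nhds_in_open) auto
  thus "\<forall>\<^sub>F x::real in nhds 0. (\<lambda>n. fps_nth (Abs_fps (\<lambda>n. (-1) ^ Suc n / of_nat n)) n * x ^ n) sums ln (1 + x)"
  proof eventually_elim
    case (elim x)
    have "(\<lambda>n. - ((- x) ^ n) / of_nat n) sums ln (1 + x)"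
      using elim by (intro ln_series') auto
    moreover have "(- x) ^ n = (-1) ^ n * x ^ n" for n
      by (rule power_minus)
    ultimately show ?case by simp
  qed
qed

theorem x_over_ln_has_fps_expansion: "x_over_ln has_fps_expansion Abs_fps bernoulli2"
proof -
  define G :: "real fps" where "G = Abs_fps (\<lambda>n. (-1) ^ Suc n / of_nat n)"
  have sub: "subdegree G = 1"
    by (rule subdegreeI) (auto simp: G_def)
  have nz: "G \<noteq> 0" using sub by auto
  have "(\<lambda>x. if x = 0 then 1 else x / ln (1 + x)) has_fps_expansion (fps_X / G)"
    using nz ln_one_plus_has_fps_expansion sub unfolding G_def[symmetric]
    by (intro has_fps_expansion_divide fps_expansion_intros) (auto simp: G_def)
  hence *: "x_over_ln has_fps_expansion (fps_X / G)"
    by (simp add: x_over_ln_def [abs_def])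
  have "fps_X / G = Abs_fps bernoulli2"
    by (rule fps_ext) (simp add: bernoulli2_def higher_deriv_at_0_has_fps_expansion[OF *])
  with * show ?thesis by simp
qed

corollary bernoulli2_sums:
  "\<forall>\<^sub>F x in nhds 0. (\<lambda>n. bernoulli2 n * x ^ n) sums x_over_ln x"
proof -
  have "eventually (\<lambda>x. x \<in> eball 0 (fps_conv_radius (Abs_fps bernoulli2))) (nhds 0)"
    using x_over_ln_has_fps_expansion
    by (intro eventually_nhds_in_open) (auto simp: has_fps_expansion_def zero_ereal_def)
  moreover have "eventually (\<lambda>x. eval_fps (Abs_fps bernoulli2) x = x_over_ln x) (nhds 0)"
    using x_over_ln_has_fps_expansion by (auto simp: has_fps_expansion_def)
  ultimately show ?thesis
  proof eventually_elim
    case (elim x)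
    thus ?case using sums_eval_fps[of x "Abs_fps bernoulli2"] by (simp add: in_eball_iff)
  qed
qed

text \<open>An \<open>m\<close>-tuple is a list of length \<open>m\<close>; the entry $x_{i+1}$ is \<open>xs ! i\<close>, and
  $x_{[i+1]}$ is \<open>desc xs ! i\<close>.\<close>

definition desc :: "real list \<Rightarrow> real list" where
  "desc xs = rev (sort xs)"

definition majorized :: "real list \<Rightarrow> real list \<Rightarrow> bool" (infix "\<preceq>" 50) where
  "xs \<preceq> ys \<longleftrightarrow>
     length xs = length ys \<and>
     (\<forall>k\<in>{1..<length xs}. (\<Sum>i<k. desc xs ! i) \<le> (\<Sum>i<k. desc ys ! i)) \<and>
     (\<Sum>i<length xs. xs ! i) = (\<Sum>i<length ys. ys ! i)"

end

theory Submission
  imports Defs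
begin

text \<open>Integrating the binomial series of $(1+x)^t$ over $t \in [0,1]$ gives
  $b_n = \int_0^1 {t \choose n}\,dt$, so $n!\,|b_{n+1}| = \int_0^1 q_n(t)\,dt$ with
  $q_n(t) = (-1)^n n! {t \choose n+1} \ge 0$. The ratios
  $q_{n+1}(t)/q_n(t) = \frac{n+1}{n+2}(n+1-t)$ increase with $n$, which makes $n!\,|b_{n+1}|$
  log-convex by a Cauchy--Schwarz argument. The theorem is then Karamata's inequality for
  the convex sequence $\ln(n!\,|b_{n+1}|)$.\<close>

section \<open>Karamata's inequality for convex sequences\<close>

text \<open>Abel summation done by induction: the partial sum up to \<open>n\<close> is nonnegative,
  so lowering its weight from \<open>c n\<close> to \<open>c (Suc n)\<close> can only decrease the
  product.\<close>

lemma antimono_weighted_sum_ge: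
  fixes c u :: "nat \<Rightarrow> real"
  assumes "\<And>i. i < n \<Longrightarrow> c (Suc i) \<le> c i"
    and "\<And>k. k < n \<Longrightarrow> 0 \<le> (\<Sum>i\<le>k. u i)"
  shows "c n * (\<Sum>i\<le>n. u i) \<le> (\<Sum>i\<le>n. c i * u i)"
  using assms
proof (induction n)
  case 0
  then show ?case by simp
next
  case (Suc n)
  have "c (Suc n) * (\<Sum>i\<le>n. u i) \<le> c n * (\<Sum>i\<le>n. u i)"
    using Suc.prems by (intro mult_right_mono) auto
  also have "\<dots> \<le> (\<Sum>i\<le>n. c i * u i)"
    using Suc by simp
  finally show ?case by (simp add: distrib_left)
qed

text \<open>Telescope \<open>f y - f x\<close> into forward differences: those to the right of
  \<open>x\<close> are at least the one at \<open>x\<close>, those to the left at most that.\<close>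

lemma convex_seq_subgradient:
  fixes f :: "nat \<Rightarrow> real"
  assumes "\<And>n. f (Suc n) - f n \<le> f (Suc (Suc n)) - f (Suc n)"
  shows "(f (Suc x) - f x) * (real y - real x) \<le> f y - f x"
proof -
  define d where "d n = f (Suc n) - f n" for n
  have mono: "d i \<le> d j" if "i \<le> j" for i j
    using lift_Suc_mono_le[of d, OF _ that] assms by (simp add: d_def)
  have "d x * (real y - real x) \<le> f y - f x"
  proof (cases "x \<le> y")
    case True
    have "(\<Sum>i\<in>{x..<y}. d x) \<le> (\<Sum>i\<in>{x..<y}. d i)"
      by (intro sum_mono mono) auto
    then show ?thesis
      using True by (simp add: d_def sum_Suc_diff' of_nat_diff mult.commute)
  next
    case False
    have "(\<Sum>i\<in>{y..<x}. d i) \<le> (\<Sum>i\<in>{y..<x}. d x)"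
      by (intro sum_mono mono) auto
    then show ?thesis
      using False by (simp add: d_def sum_Suc_diff' of_nat_diff algebra_simps)
  qed
  then show ?thesis by (simp add: d_def)
qed

lemma desc_map_real: "desc (map real xs) = map real (rev (sort xs))"
proof -
  have "sorted (map real (sort xs))"
    by (simp add: sorted_map sorted_wrt_mono_rel[OF _ sorted_sort])
  then have "sort (map real xs) = map real (sort xs)"
    by (intro properties_for_sort) simp_all
  then show ?thesis by (simp add: desc_def rev_map)
qed

lemma sum_nth_sort_desc:
  fixes f :: "nat \<Rightarrow> real"
  shows "(\<Sum>i<length xs. f (rev (sort xs) ! i)) = (\<Sum>i<length xs. f (xs ! i))"
proof -
  have "(\<Sum>i<length zs. f (zs ! i)) = sum_mset (image_mset f (mset zs))" for zs
    by (simp add: sum_mset_sum_list sum_list_sum_nth atLeast0LessThan flip: mset_map)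
  from this[of "rev (sort xs)"] this[of xs] show ?thesis by simp
qed

text \<open>With both tuples sorted descending, the subgradients \<open>c i\<close> at
  \<open>x i\<close> bound the gap between the two sums from below by a weighted sum of the
  \<open>u i\<close>. Abel summation shows that this weighted sum is nonnegative.\<close>

theorem majorized_sum_convex_seq_le:
  fixes f :: "nat \<Rightarrow> real"
  assumes convex: "\<And>n. f (Suc n) - f n \<le> f (Suc (Suc n)) - f (Suc n)"
    and maj: "map real xs \<preceq> map real ys"
  shows "(\<Sum>i<length xs. f (xs ! i)) \<le> (\<Sum>i<length ys. f (ys ! i))"
proof (cases "length xs")
  case 0
  with maj show ?thesis by (simp add: majorized_def)
next
  case (Suc n)
  define x where "x i = rev (sort xs) ! i" for i
  define y where "y i = rev (sort ys) ! i" for i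
  define c where "c i = f (Suc (x i)) - f (x i)" for i
  define u where "u i = real (y i) - real (x i)" for i
  have len: "length ys = Suc n"
    using maj Suc by (simp add: majorized_def)
  have sums: "(\<Sum>i\<le>k. u i) = (\<Sum>i<Suc k. desc (map real ys) ! i) - (\<Sum>i<Suc k. desc (map real xs) ! i)"
    if "k \<le> n" for k
    unfolding desc_map_real sum_subtractf[symmetric] lessThan_Suc_atMost
    by (intro sum.cong) (use that len Suc in \<open>auto simp: u_def x_def y_def\<close>)
  \<comment> \<open>The sum up to \<open>k\<close> has \<open>Suc k\<close> terms, so
    \<open>k < n\<close> covers exactly the inequalities in majorization; \<open>k = n\<close> is
    its equality, treated next.\<close>
  have partial: "0 \<le> (\<Sum>i\<le>k. u i)" if "k < n" for k
  proof -
    have "Suc k \<in> {1..<length (map real xs)}" using that Suc by simp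
    with maj have "(\<Sum>i<Suc k. desc (map real xs) ! i) \<le> (\<Sum>i<Suc k. desc (map real ys) ! i)"
      unfolding majorized_def by blast
    then show ?thesis using sums[of k] that by linarith
  qed
  have total: "(\<Sum>i\<le>n. u i) = 0"
  proof -
    have "(\<Sum>i<length xs. real (xs ! i)) = (\<Sum>i<length ys. real (ys ! i))"
      using maj by (auto simp: majorized_def)
    then have "(\<Sum>i<Suc n. real (x i)) = (\<Sum>i<Suc n. real (y i))"
      using sum_nth_sort_desc[of real xs] sum_nth_sort_desc[of real ys] Suc len
      by (simp add: x_def y_def)
    then show ?thesis
      by (simp add: u_def sum_subtractf lessThan_Suc_atMost)
  qed
  have "c (Suc i) \<le> c i" if "i < n" for i
  proof -
    have "x (Suc i) \<le> x i"
      unfolding x_def using that Suc by (intro sorted_rev_nth_mono) auto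
    then show ?thesis
      unfolding c_def by (rule lift_Suc_mono_le[of "\<lambda>k. f (Suc k) - f k", OF convex])
  qed
  \<comment> \<open>The lower bound is \<open>c n\<close> times the total of \<open>u\<close>, which
    vanishes, so the sign of \<open>c n\<close> is irrelevant.\<close>
  from antimono_weighted_sum_ge[of n c u, OF this partial]
  have "0 \<le> (\<Sum>i\<le>n. c i * u i)" by (simp add: total)
  also have "\<dots> \<le> (\<Sum>i\<le>n. f (y i) - f (x i))"
    unfolding c_def u_def by (intro sum_mono convex_seq_subgradient convex)
  finally have "(\<Sum>i<Suc n. f (x i)) \<le> (\<Sum>i<Suc n. f (y i))"
    by (simp add: sum_subtractf lessThan_Suc_atMost)
  then show ?thesis
    using sum_nth_sort_desc[of f xs] sum_nth_sort_desc[of f ys] Suc len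
    by (simp add: x_def y_def)
qed

section \<open>The integral representation\<close>

lemma gbinomial_Suc_real:
  fixes t :: real
  shows "t gchoose Suc n = (t gchoose n) * ((t - real n) / real (Suc n))"
  using gbinomial_mult_1[of t n] by (simp add: field_simps)

text \<open>Each new factor \<open>(t - real n) / real (Suc n)\<close> has absolute value at most 1.
  This bounds the binomial series by a geometric one, uniformly in \<open>t\<close>.\<close>

lemma abs_gbinomial_unit_interval_le_1:
  fixes t :: real
  assumes "t \<in> {0..1}"
  shows "\<bar>t gchoose n\<bar> \<le> 1"
proof (induction n)
  case (Suc n)
  have "\<bar>t gchoose Suc n\<bar> = \<bar>t gchoose n\<bar> * (\<bar>t - real n\<bar> / real (Suc n))"
    by (simp add: gbinomial_Suc_real abs_mult)
  also have "\<dots> \<le> 1 * 1"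
    using Suc assms by (intro mult_mono) (auto simp: divide_le_eq)
  finally show ?case by simp
qed simp

lemma continuous_on_gbinomial [continuous_intros]:
  "continuous_on A (\<lambda>t::real. t gchoose n)"
  unfolding gbinomial_prod_rev by (intro continuous_intros) auto

text \<open>For nonzero \<open>x\<close>, an antiderivative in \<open>t\<close> is
  \<open>(1 + x) powr t / ln (1 + x)\<close>; at \<open>x = 0\<close> the integrand is 1, which
  matches the extended value.\<close>

lemma has_integral_one_plus_powr:
  fixes x :: real
  assumes "\<bar>x\<bar> < 1"
  shows "((\<lambda>t. (1 + x) powr t) has_integral x_over_ln x) {0..1}"
proof (cases "x = 0")
  case True
  have "((\<lambda>t::real. 1::real) has_integral 1) {0..1}"
    using has_integral_const_real[of "1::real" 0 1] by simp
  with True show ?thesis by (simp add: x_over_ln_def)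
next
  case False
  have ln: "ln (1 + x) \<noteq> 0" using assms False by simp
  have "((\<lambda>t. (1 + x) powr t / ln (1 + x)) has_real_derivative (1 + x) powr t) (at t)" for t
    using DERIV_cdivide[OF has_real_derivative_const_powr[OF DERIV_ident], of "1 + x" "ln (1 + x)" t] ln
    by simp
  then have "((\<lambda>t. (1 + x) powr t) has_integral
      (1 + x) powr 1 / ln (1 + x) - (1 + x) powr 0 / ln (1 + x)) {0..1}"
    by (intro fundamental_theorem_of_calculus)
      (auto simp flip: has_real_derivative_iff_has_vector_derivative
        intro: has_field_derivative_at_within)
  moreover have "0 < 1 + x" using assms by auto
  ultimately show ?thesis
    using False by (simp add: x_over_ln_def diff_divide_distrib[symmetric])
qed

text \<open>The binomial series converges uniformly in \<open>t\<close> by the M-test, so it may be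
  integrated term by term.\<close>

lemma integral_gbinomial_sums:
  fixes x :: real
  assumes x: "\<bar>x\<bar> < 1"
  shows "(\<lambda>n. integral {0..1} (\<lambda>t. t gchoose n) * x ^ n) sums x_over_ln x"
proof -
  let ?S = "\<lambda>N t. \<Sum>n<N. (t gchoose n) * x ^ n"
  have "uniform_limit {0..1} ?S (\<lambda>t. \<Sum>n. (t gchoose n) * x ^ n) sequentially"
  proof (rule Weierstrass_m_test)
    fix n and t :: real assume "t \<in> {0..1}"
    from abs_gbinomial_unit_interval_le_1[OF this, of n]
    show "norm ((t gchoose n) * x ^ n) \<le> \<bar>x\<bar> ^ n"
      using mult_right_mono[of _ 1 "\<bar>x\<bar> ^ n"] by (simp add: abs_mult power_abs)
  qed (use x in \<open>simp add: summable_geometric\<close>)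
  also have "(\<lambda>t. \<Sum>n. (t gchoose n) * x ^ n) = (\<lambda>t. (1 + x) powr t)"
    using gen_binomial_real[OF x] by (auto simp: sums_iff)
  finally have lim: "uniform_limit {0..1} ?S (\<lambda>t. (1 + x) powr t) sequentially" .
  have cont: "continuous_on {0..1} (?S N)" for N
    by (intro continuous_intros)
  \<comment> \<open>The integrals come as mere existence claims; uniqueness of the integral then
    identifies \<open>J\<close>, and linearity identifies \<open>I\<close>.\<close>
  obtain I J where I: "\<And>N. (?S N has_integral I N) {0..1}"
    and J: "((\<lambda>t. (1 + x) powr t) has_integral J) {0..1}" and IJ: "I \<longlonglongrightarrow> J"
    using uniform_limit_integral[OF lim cont] by auto
  have "J = x_over_ln x"
    using has_integral_unique[OF J has_integral_one_plus_powr[OF x]] .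
  moreover have "I = (\<lambda>N. \<Sum>n<N. integral {0..1} (\<lambda>t. t gchoose n) * x ^ n)"
  proof
    fix N
    have "I N = integral {0..1} (?S N)" using I[of N] by (simp add: integral_unique)
    also have "\<dots> = (\<Sum>n<N. integral {0..1} (\<lambda>t. (t gchoose n) * x ^ n))"
      by (intro integral_sum integrable_continuous_real continuous_intros) auto
    finally show "I N = (\<Sum>n<N. integral {0..1} (\<lambda>t. t gchoose n) * x ^ n)" by simp
  qed
  ultimately show ?thesis using IJ unfolding sums_def by simp
qed

text \<open>A power series expansion at 0 determines the derivatives there, hence the
  coefficients.\<close>

theorem bernoulli2_eq_integral: "bernoulli2 n = integral {0..1} (\<lambda>t. t gchoose n)"
proof -
  have "eventually (\<lambda>x::real. x \<in> {-1<..<1}) (nhds 0)"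
    by (intro eventually_nhds_in_open) auto
  then have "\<forall>\<^sub>F x in nhds 0.
      (\<lambda>n. fps_nth (Abs_fps (\<lambda>n. integral {0..1} (\<lambda>t. t gchoose n))) n * x ^ n) sums x_over_ln x"
    by eventually_elim (simp add: integral_gbinomial_sums abs_less_iff)
  then have "x_over_ln has_fps_expansion Abs_fps (\<lambda>n. integral {0..1} (\<lambda>t. t gchoose n))"
    by (rule has_fps_expansionI)
  from higher_deriv_at_0_has_fps_expansion[OF this, of n] show ?thesis
    by (simp add: bernoulli2_def)
qed

section \<open>Log-convexity\<close>

text \<open>Named after the Gregory coefficients, another name of the numbers
  \<open>bernoulli2 n\<close>. On [0,1] the product in \<open>t gchoose Suc n\<close> has
  \<open>n\<close> nonpositive factors \<open>t - k\<close> besides \<open>t\<close>, whence the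
  sign.\<close>

definition gregory_density :: "nat \<Rightarrow> real \<Rightarrow> real" where
  "gregory_density n t = (- 1) ^ n * fact n * (t gchoose Suc n)"

lemma gregory_density_0: "gregory_density 0 t = t"
  by (simp add: gregory_density_def)

lemma gregory_density_Suc:
  "gregory_density (Suc n) t =
     gregory_density n t * (real (Suc n) / real (Suc (Suc n)) * (real (Suc n) - t))"
proof -
  have "t gchoose Suc (Suc n) =
      - ((t gchoose Suc n) * ((real (Suc n) - t) / real (Suc (Suc n))))"
    by (subst gbinomial_Suc_real) (simp add: minus_divide_left flip: mult_minus_right)
  then show ?thesis by (simp add: gregory_density_def)
qed

lemma gregory_density_nonneg: "t \<in> {0..1} \<Longrightarrow> 0 \<le> gregory_density n t"
  by (induction n) (auto simp: gregory_density_0 gregory_density_Suc)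

lemma gregory_density_pos: "t \<in> {0<..<1} \<Longrightarrow> 0 < gregory_density n t"
  by (induction n) (auto simp: gregory_density_0 gregory_density_Suc)

lemma continuous_on_gregory_density: "continuous_on A (gregory_density n)"
  unfolding gregory_density_def by (intro continuous_intros)

lemma integrable_gregory_density: "gregory_density n integrable_on {0..1}"
  by (intro integrable_continuous_real continuous_on_gregory_density)

text \<open>A continuous nonnegative function with zero integral vanishes identically, but this one
  is positive at 1/2.\<close>

lemma integral_gregory_density_pos: "0 < integral {0..1} (gregory_density n)"
proof -
  have "integral {0..1} (gregory_density n) \<noteq> 0"
    using integral_eq_0_iff[OF continuous_on_gregory_density, of 0 1 n]
      gregory_density_nonneg gregory_density_pos[of "1/2" n] by force
  moreover have "0 \<le> integral {0..1} (gregory_density n)"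
    by (intro integral_nonneg integrable_gregory_density gregory_density_nonneg)
  ultimately show ?thesis by linarith
qed

lemma abs_fact_bernoulli2:
  "\<bar>fact n * bernoulli2 (n + 1)\<bar> = integral {0..1} (gregory_density n)"
proof -
  have "integral {0..1} (gregory_density n) = (- 1) ^ n * (fact n * bernoulli2 (n + 1))"
    by (simp add: gregory_density_def[abs_def] bernoulli2_eq_integral mult.assoc)
  then have "\<bar>integral {0..1} (gregory_density n)\<bar> = \<bar>fact n * bernoulli2 (n + 1)\<bar>"
    by (simp add: abs_mult)
  then show ?thesis using integral_gregory_density_pos[of n] by simp
qed

text \<open>Integrated over $[0,1]$ with \<open>c\<close> the quotient of consecutive integrals, this yields the
  Cauchy--Schwarz step without invoking that inequality.\<close>

lemma gregory_density_quadratic_bound: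
  assumes t: "t \<in> {0..1}"
  shows "2 * c * gregory_density (Suc n) t - c\<^sup>2 * gregory_density n t
    \<le> gregory_density (Suc (Suc n)) t"
proof -
  define r where "r k = real (Suc k) / real (Suc (Suc k)) * (real (Suc k) - t)" for k
  \<comment> \<open>Both factors of \<open>r k\<close> are nonnegative and increase with
    \<open>k\<close>.\<close>
  have "r n \<le> r (Suc n)"
    unfolding r_def using t by (intro mult_mono) (auto simp: field_simps)
  moreover have "0 \<le> r n" using t by (auto simp: r_def)
  ultimately have "r n * r n \<le> r n * r (Suc n)" by (intro mult_left_mono)
  moreover have "0 \<le> (r n - c)\<^sup>2" by simp
  ultimately have "2 * c * r n - c\<^sup>2 \<le> r n * r (Suc n)"
    by (simp add: power2_eq_square algebra_simps)
  then have "gregory_density n t * (2 * c * r n - c\<^sup>2)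
      \<le> gregory_density n t * (r n * r (Suc n))"
    using gregory_density_nonneg[OF t] by (intro mult_left_mono)
  moreover have "gregory_density (Suc n) t = gregory_density n t * r n"
    "gregory_density (Suc (Suc n)) t = gregory_density n t * r n * r (Suc n)"
    by (simp_all only: gregory_density_Suc r_def)
  ultimately show ?thesis by (simp add: algebra_simps)
qed

lemma integral_gregory_density_log_convex:
  "(integral {0..1} (gregory_density (Suc n)))\<^sup>2
    \<le> integral {0..1} (gregory_density n) * integral {0..1} (gregory_density (Suc (Suc n)))"
proof -
  define I where "I k = integral {0..1} (gregory_density k)" for k
  have pos: "0 < I n" unfolding I_def by (rule integral_gregory_density_pos)
  \<comment> \<open>This choice maximizes \<open>2 * c * I (Suc n) - c\<^sup>2 * I n\<close>, with
    maximum \<open>(I (Suc n))\<^sup>2 / I n\<close>.\<close>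
  define c where "c = I (Suc n) / I n"
  have has: "(gregory_density k has_integral I k) {0..1}" for k
    unfolding I_def by (rule integrable_integral[OF integrable_gregory_density])
  have "2 * c * I (Suc n) - c\<^sup>2 * I n \<le> I (Suc (Suc n))"
    by (rule has_integral_le[OF has_integral_diff[OF has_integral_mult_right[OF has]
          has_integral_mult_right[OF has]] has]) (rule gregory_density_quadratic_bound)
  then have "(I (Suc n))\<^sup>2 \<le> I n * I (Suc (Suc n))"
    using pos by (simp add: c_def field_simps power2_eq_square)
  then show ?thesis by (simp add: I_def)
qed

theorem theorem5p3:
  fixes m :: nat and ls ms :: "nat list"
  assumes "m > 0" and "length ls = m" and "length ms = m"
    and "map real ls \<preceq> map real ms"
  shows "\<bar>\<Prod>i<m. fact (ls ! i) * bernoulli2 (ls ! i + 1)\<bar>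
       \<le> \<bar>\<Prod>i<m. fact (ms ! i) * bernoulli2 (ms ! i + 1)\<bar>"
proof -
  define I where "I k = integral {0..1} (gregory_density k)" for k
  have pos: "0 < I k" for k unfolding I_def by (rule integral_gregory_density_pos)
  have sq: "(I (Suc n))\<^sup>2 \<le> I n * I (Suc (Suc n))" for n
    unfolding I_def by (rule integral_gregory_density_log_convex)
  \<comment> \<open>Positivity allows taking logarithms, which turns log-convexity into the
    increasing differences that Karamata requires.\<close>
  have "ln (I (Suc n)) - ln (I n) \<le> ln (I (Suc (Suc n))) - ln (I (Suc n))" for n
  proof -
    have "ln ((I (Suc n))\<^sup>2) \<le> ln (I n * I (Suc (Suc n)))"
      using sq pos[of "Suc n"] by (intro ln_mono) simp_all
    then show ?thesis
      using pos[of n] pos[of "Suc n"] pos[of "Suc (Suc n)"] by (simp add: ln_mult ln_realpow)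
  qed
  from majorized_sum_convex_seq_le[of "\<lambda>k. ln (I k)", OF this assms(4)] assms(2,3)
  have "exp (\<Sum>i<m. ln (I (ls ! i))) \<le> exp (\<Sum>i<m. ln (I (ms ! i)))" by simp
  then show ?thesis
    using pos by (simp only: abs_prod abs_fact_bernoulli2 exp_sum finite_lessThan I_def[symmetric] exp_ln)
qed

end
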